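(* Let $K$ be a finite simplicial complex with a simplexwise filtration $K_\bullet$, given by a total order $\sigma_1,\dots,\sigma_m$ of its simplices. Then the apparent pairs of $K_\bullet$ form a discrete gradient; that is, there is a discrete Morse function $f\colon K\to\mathbb R$ such that the pairs in the discrete gradient of $f$ are exactly the apparent pairs of $K_\bullet$.
   Context: Simplices are nonempty finite sets, $\dim\sigma=|\sigma|-1$, and a simplicial complex is a collection of simplices closed under taking nonempty subsets. $\sigma$ is a facet of $\tau$ (and $\tau$ a cofacet of $\sigma$) if $\sigma\subset\tau$ and $\dim\tau=\dim\sigma+1$; facets and cofacets are taken among the simplices of $K$. Simplexwise filtration: a total order $\sigma_1,\dots,\sigma_m$ of all simplices of $K$ in which every simplex comes after all its proper faces; the filtration is $K_0=\emptyset$, $K_i=\{\sigma_1,\dots,\sigma_i\}$. A simplex is older than another if it comes earlier in this order, and younger if it comes later. Apparent pair: a pair $(\sigma,\tau)$ of simplices of $K$ such that $\sigma$ is the youngest facet of $\tau$ and $\tau$ is the oldest cofacet of $\sigma$. Discrete vector field on $K$: a partition of $K$ into singletons and pairs $\{\sigma,\tau\}$ with $\sigma$ a facet of $\tau$. A function $f\colon K\to\mathbb R$ is monotonic if $\sigma\subseteq\tau$ implies $f(\sigma)\le f(\tau)$. A monotonic $f$ is a discrete Morse function if the pairs $\{\sigma,\tau\}$ with $\sigma$ a facet of $\tau$ and $f(\sigma)=f(\tau)$ are pairwise disjoint, so that together with the remaining singletons they form a discrete vector field; this discrete vector field is called the discrete gradient of $f$. *)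

theory Defs
  imports Complex_Main "HOL-Library.Disjoint_Sets"
begin

text \<open>
  Abstract simplicial complexes; the constant of the same name in HOL-Analysis is about geometric
  simplices in Euclidean space.  The empty set is not a simplex.
\<close>

definition simplicial_complex :: "'a set set \<Rightarrow> bool" where
  "simplicial_complex K \<longleftrightarrow>
     (\<forall>\<sigma>\<in>K. finite \<sigma> \<and> \<sigma> \<noteq> {}) \<and>
     (\<forall>\<sigma>\<in>K. \<forall>\<rho>. \<rho> \<subseteq> \<sigma> \<longrightarrow> \<rho> \<noteq> {} \<longrightarrow> \<rho> \<in> K)"

definition simplex_dim :: "'a set \<Rightarrow> int" where
  "simplex_dim \<sigma> = int (card \<sigma>) - 1"

text \<open>
  \<open>facet K \<sigma> \<tau>\<close> says that \<open>\<sigma>\<close> is a facet of \<open>\<tau>\<close>, equivalently that \<open>\<tau>\<close> is a cofacet of \<open>\<sigma>\<close>.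
\<close>

definition facet :: "'a set set \<Rightarrow> 'a set \<Rightarrow> 'a set \<Rightarrow> bool" where
  "facet K \<sigma> \<tau> \<longleftrightarrow>
     \<sigma> \<in> K \<and> \<tau> \<in> K \<and> \<sigma> \<subset> \<tau> \<and> simplex_dim \<tau> = simplex_dim \<sigma> + 1"

text \<open>
  A simplexwise filtration is represented by the list \<open>xs = [\<sigma>\<^sub>1, \<dots>, \<sigma>\<^sub>m]\<close> of all simplices in
  filtration order; the \<open>i\<close>-th complex of the filtration is \<open>set (take i xs)\<close>.
\<close>

definition simplexwise_filtration :: "'a set set \<Rightarrow> 'a set list \<Rightarrow> bool" where
  "simplexwise_filtration K xs \<longleftrightarrow>
     distinct xs \<and> set xs = K \<and>
     (\<forall>i < length xs. \<forall>j < length xs. xs ! i \<subset> xs ! j \<longrightarrow> i < j)"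

definition older :: "'a set list \<Rightarrow> 'a set \<Rightarrow> 'a set \<Rightarrow> bool" where
  "older xs \<sigma> \<tau> \<longleftrightarrow> (\<exists>i j. i < j \<and> j < length xs \<and> \<sigma> = xs ! i \<and> \<tau> = xs ! j)"

definition youngest_facet :: "'a set set \<Rightarrow> 'a set list \<Rightarrow> 'a set \<Rightarrow> 'a set \<Rightarrow> bool" where
  "youngest_facet K xs \<sigma> \<tau> \<longleftrightarrow>
     facet K \<sigma> \<tau> \<and> (\<forall>\<rho>. facet K \<rho> \<tau> \<longrightarrow> \<rho> \<noteq> \<sigma> \<longrightarrow> older xs \<rho> \<sigma>)"

definition oldest_cofacet :: "'a set set \<Rightarrow> 'a set list \<Rightarrow> 'a set \<Rightarrow> 'a set \<Rightarrow> bool" where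
  "oldest_cofacet K xs \<tau> \<sigma> \<longleftrightarrow>
     facet K \<sigma> \<tau> \<and> (\<forall>\<rho>. facet K \<sigma> \<rho> \<longrightarrow> \<rho> \<noteq> \<tau> \<longrightarrow> older xs \<tau> \<rho>)"

definition apparent_pairs :: "'a set set \<Rightarrow> 'a set list \<Rightarrow> ('a set \<times> 'a set) set" where
  "apparent_pairs K xs =
     {(\<sigma>, \<tau>). youngest_facet K xs \<sigma> \<tau> \<and> oldest_cofacet K xs \<tau> \<sigma>}"

definition discrete_vector_field :: "'a set set \<Rightarrow> 'a set set set \<Rightarrow> bool" where
  "discrete_vector_field K V \<longleftrightarrow>
     partition_on K V \<and>
     (\<forall>b\<in>V. (\<exists>\<sigma>. b = {\<sigma>}) \<or> (\<exists>\<sigma> \<tau>. facet K \<sigma> \<tau> \<and> b = {\<sigma>, \<tau>}))"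

text \<open>
  The blocks of size two of a discrete vector field, with the facet as first component.
\<close>

definition vector_field_pairs :: "'a set set \<Rightarrow> 'a set set set \<Rightarrow> ('a set \<times> 'a set) set" where
  "vector_field_pairs K V = {(\<sigma>, \<tau>). facet K \<sigma> \<tau> \<and> {\<sigma>, \<tau>} \<in> V}"

text \<open>
  Functions on \<open>K\<close> are total functions on sets of vertices; their values outside \<open>K\<close> are never used.
\<close>

definition monotonic :: "'a set set \<Rightarrow> ('a set \<Rightarrow> real) \<Rightarrow> bool" where
  "monotonic K f \<longleftrightarrow> (\<forall>\<sigma>\<in>K. \<forall>\<tau>\<in>K. \<sigma> \<subseteq> \<tau> \<longrightarrow> f \<sigma> \<le> f \<tau>)"

definition level_pairs :: "'a set set \<Rightarrow> ('a set \<Rightarrow> real) \<Rightarrow> 'a set set set" where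
  "level_pairs K f = {{\<sigma>, \<tau>} | \<sigma> \<tau>. facet K \<sigma> \<tau> \<and> f \<sigma> = f \<tau>}"

definition discrete_morse_function :: "'a set set \<Rightarrow> ('a set \<Rightarrow> real) \<Rightarrow> bool" where
  "discrete_morse_function K f \<longleftrightarrow> monotonic K f \<and> disjoint (level_pairs K f)"

definition discrete_gradient :: "'a set set \<Rightarrow> ('a set \<Rightarrow> real) \<Rightarrow> 'a set set set" where
  "discrete_gradient K f =
     level_pairs K f \<union> {{\<sigma>} | \<sigma>. \<sigma> \<in> K \<and> \<sigma> \<notin> \<Union> (level_pairs K f)}"

lemma discrete_vector_field_discrete_gradient:
  assumes "discrete_morse_function K f"
  shows "discrete_vector_field K (discrete_gradient K f)"
proof -
  have sub: "\<Union> (level_pairs K f) \<subseteq> K"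
    by (auto simp: level_pairs_def facet_def)
  have ne: "{} \<notin> level_pairs K f"
    by (auto simp: level_pairs_def)
  have dis: "disjoint (level_pairs K f)"
    using assms by (simp add: discrete_morse_function_def)
  have "partition_on K (discrete_gradient K f)"
    unfolding partition_on_def
  proof (intro conjI)
    show "\<Union> (discrete_gradient K f) = K"
      using sub unfolding discrete_gradient_def by blast
    show "disjoint (discrete_gradient K f)"
      using dis by (auto simp: discrete_gradient_def disjoint_def)
    show "{} \<notin> discrete_gradient K f"
      using ne by (auto simp: discrete_gradient_def)
  qed
  then show ?thesis
    by (auto simp: discrete_vector_field_def discrete_gradient_def level_pairs_def)
qed

end

theory Submission
  imports Defs
begin

text \<open>
  Let \<open>f\<close> send a simplex to its position in the filtration, except that the facet of an apparent
  pair takes the position of its cofacet.  Raising \<open>f \<sigma>\<close> to the position of \<open>\<tau>\<close> keeps \<open>f\<close>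
  monotonic because \<open>\<tau>\<close> is the oldest cofacet of \<open>\<sigma>\<close> and every proper coface of \<open>\<sigma>\<close> contains
  a cofacet of \<open>\<sigma>\<close>.  A facet and its cofacet get the same value exactly if they are an apparent
  pair; this requires that the cofacet \<open>\<tau>\<close> of an apparent pair is not itself the facet of another
  apparent pair \<open>(\<tau>, \<omega>)\<close>, which holds because of the second simplex between \<open>\<sigma>\<close> and \<open>\<omega>\<close>.
\<close>

text \<open>Simplices are finite, so the dimension condition in \<open>facet\<close> says that
  \<open>\<tau> - \<sigma>\<close> has exactly one vertex. This form makes facets constructible by
  \<open>insert\<close>.\<close>

lemma facet_iff_insert:
  assumes "simplicial_complex K"
  shows "facet K \<sigma> \<tau> \<longleftrightarrow> \<sigma> \<in> K \<and> \<tau> \<in> K \<and> (\<exists>v. v \<notin> \<sigma> \<and> \<tau> = insert v \<sigma>)"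
proof
  assume F: "facet K \<sigma> \<tau>"
  then have "finite \<tau>" and sub: "\<sigma> \<subset> \<tau>" and K: "\<sigma> \<in> K" "\<tau> \<in> K"
    using assms by (auto simp: facet_def simplicial_complex_def)
  moreover have "card \<tau> = card \<sigma> + 1"
    using F by (simp add: facet_def simplex_dim_def)
  moreover have "card (\<tau> - \<sigma>) = card \<tau> - card \<sigma>"
    using \<open>finite \<tau>\<close> sub by (intro card_Diff_subset) (auto intro: finite_subset)
  ultimately have "card (\<tau> - \<sigma>) = 1"
    by simp
  then obtain v where "\<tau> - \<sigma> = {v}"
    by (auto simp: card_1_singleton_iff)
  then have "v \<notin> \<sigma>" "\<tau> = insert v \<sigma>"
    using sub by auto
  then show "\<sigma> \<in> K \<and> \<tau> \<in> K \<and> (\<exists>v. v \<notin> \<sigma> \<and> \<tau> = insert v \<sigma>)"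
    using K by blast
next
  assume "\<sigma> \<in> K \<and> \<tau> \<in> K \<and> (\<exists>v. v \<notin> \<sigma> \<and> \<tau> = insert v \<sigma>)"
  then show "facet K \<sigma> \<tau>"
    using assms by (auto simp: facet_def simplex_dim_def simplicial_complex_def)
qed

text \<open>Adding to \<open>\<sigma>\<close> a single vertex of \<open>\<tau> - \<sigma>\<close>
  stays below \<open>\<tau>\<close>, hence in \<open>K\<close>.\<close>

lemma cofacet_below_coface:
  assumes "simplicial_complex K" "\<sigma> \<in> K" "\<tau> \<in> K" "\<sigma> \<subset> \<tau>"
  obtains \<rho> where "facet K \<sigma> \<rho>" "\<rho> \<subseteq> \<tau>"
proof -
  obtain v where v: "v \<in> \<tau>" "v \<notin> \<sigma>"
    using assms(4) by blast
  moreover have "insert v \<sigma> \<in> K"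
    using assms v unfolding simplicial_complex_def
    by (metis insert_not_empty insert_subset psubset_imp_subset)
  ultimately show thesis
    using that[of "insert v \<sigma>"] assms by (auto simp: facet_iff_insert)
qed

text \<open>If \<open>\<tau>\<close> adds \<open>v\<close> to \<open>\<sigma>\<close> and
  \<open>\<omega>\<close> then adds \<open>w\<close>, adding \<open>w\<close> first gives the other
  simplex in between.\<close>

lemma second_intermediate_simplex:
  assumes "simplicial_complex K" "facet K \<sigma> \<tau>" "facet K \<tau> \<omega>"
  obtains \<tau>' where "\<tau>' \<noteq> \<tau>" "facet K \<sigma> \<tau>'" "facet K \<tau>' \<omega>"
proof -
  obtain v w where v: "v \<notin> \<sigma>" "\<tau> = insert v \<sigma>" and w: "w \<notin> \<tau>" "\<omega> = insert w \<tau>"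
    and K: "\<sigma> \<in> K" "\<omega> \<in> K"
    using assms by (auto simp: facet_iff_insert)
  have "insert w \<sigma> \<in> K"
    using assms(1) K v w unfolding simplicial_complex_def
    by (metis insert_not_empty insert_mono subset_insertI)
  show thesis
  proof
    show "insert w \<sigma> \<noteq> \<tau>"
      using v w by auto
    show "facet K \<sigma> (insert w \<sigma>)"
      using assms(1) v w K \<open>insert w \<sigma> \<in> K\<close> by (auto simp: facet_iff_insert)
    have "v \<notin> insert w \<sigma>" "\<omega> = insert v (insert w \<sigma>)"
      using v w by auto
    then show "facet K (insert w \<sigma>) \<omega>"
      using assms(1) K \<open>insert w \<sigma> \<in> K\<close> unfolding facet_iff_insert[OF assms(1)] by blast
  qed
qed

text \<open>Inverting list indexing turns age into a comparison of natural numbers; the list itself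
  is not inspected again.\<close>

lemma filtration_position:
  assumes "simplexwise_filtration K xs"
  obtains p :: "'a set \<Rightarrow> nat" where "inj_on p K"
    "\<And>\<sigma> \<tau>. \<sigma> \<in> K \<Longrightarrow> \<tau> \<in> K \<Longrightarrow> \<sigma> \<subset> \<tau> \<Longrightarrow> p \<sigma> < p \<tau>"
    "\<And>\<sigma> \<tau>. older xs \<sigma> \<tau> \<Longrightarrow> p \<sigma> < p \<tau>"
proof -
  have d: "distinct xs" and K: "set xs = K"
    and mono: "\<And>i j. i < length xs \<Longrightarrow> j < length xs \<Longrightarrow> xs ! i \<subset> xs ! j \<Longrightarrow> i < j"
    using assms by (auto simp: simplexwise_filtration_def)
  define p where "p = the_inv_into {..<length xs} ((!) xs)"
  have p: "p (xs ! i) = i" if "i < length xs" for i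
    unfolding p_def using that d by (intro the_inv_into_f_f) (auto simp: inj_on_nth)
  show thesis
  proof
    show "inj_on p K"
      using p K by (metis (no_types, lifting) in_set_conv_nth inj_onI)
    show "p \<sigma> < p \<tau>" if "\<sigma> \<in> K" "\<tau> \<in> K" "\<sigma> \<subset> \<tau>" for \<sigma> \<tau>
      using that p mono K by (metis in_set_conv_nth)
    show "p \<sigma> < p \<tau>" if "older xs \<sigma> \<tau>" for \<sigma> \<tau>
      using that p by (auto simp: older_def)
  qed
qed

text \<open>A facet differs from its cofacet, so the singleton blocks contribute no pairs; the order
  within a block is harmless because \<open>f \<sigma> = f \<tau>\<close> is symmetric.\<close>

lemma vector_field_pairs_discrete_gradient:
  "vector_field_pairs K (discrete_gradient K f) = {(\<sigma>, \<tau>). facet K \<sigma> \<tau> \<and> f \<sigma> = f \<tau>}"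
  by (auto simp: vector_field_pairs_def discrete_gradient_def level_pairs_def facet_def
      doubleton_eq_iff)

theorem lemma3p5:
  fixes K :: "'a set set" and xs :: "'a set list"
  assumes "simplicial_complex K"
    and "finite K"
    and "simplexwise_filtration K xs"
  shows "\<exists>f :: 'a set \<Rightarrow> real. discrete_morse_function K f \<and>
           vector_field_pairs K (discrete_gradient K f) = apparent_pairs K xs"
proof -
  obtain p :: "'a set \<Rightarrow> nat" where inj: "inj_on p K"
    and p_less: "\<And>\<sigma> \<tau>. \<sigma> \<in> K \<Longrightarrow> \<tau> \<in> K \<Longrightarrow> \<sigma> \<subset> \<tau> \<Longrightarrow> p \<sigma> < p \<tau>"
    and p_older: "\<And>\<sigma> \<tau>. older xs \<sigma> \<tau> \<Longrightarrow> p \<sigma> < p \<tau>"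
    using filtration_position[OF assms(3)] by metis
  define A where "A = apparent_pairs K xs"
  have facet: "facet K \<sigma> \<tau>" if "(\<sigma>, \<tau>) \<in> A" for \<sigma> \<tau>
    using that by (simp add: A_def apparent_pairs_def youngest_facet_def)
  \<comment> \<open>The weak inequalities here and in \<open>oldest\<close> also cover the simplex
    itself, so two opposite ones give equality by injectivity of \<open>p\<close>.\<close>
  have youngest: "p \<rho> \<le> p \<sigma>" if "(\<sigma>, \<tau>) \<in> A" "facet K \<rho> \<tau>" for \<sigma> \<tau> \<rho>
    using that p_older[of \<rho> \<sigma>]
    by (cases "\<rho> = \<sigma>") (auto simp: A_def apparent_pairs_def youngest_facet_def)
  have oldest: "p \<tau> \<le> p \<rho>" if "(\<sigma>, \<tau>) \<in> A" "facet K \<sigma> \<rho>" for \<sigma> \<tau> \<rho>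
    using that p_older[of \<tau> \<rho>]
    by (cases "\<rho> = \<tau>") (auto simp: A_def apparent_pairs_def oldest_cofacet_def)
  have eqI: "\<sigma> = \<tau>" if "p \<sigma> \<le> p \<tau>" "p \<tau> \<le> p \<sigma>" "\<sigma> \<in> K" "\<tau> \<in> K" for \<sigma> \<tau>
    using that inj by (simp add: inj_on_def)
  have in_K: "\<sigma> \<in> K" "\<tau> \<in> K" if "facet K \<sigma> \<tau>" for \<sigma> \<tau>
    using that by (auto simp: facet_def)
  have uniq_cofacet: "\<tau> = \<tau>'" if "(\<sigma>, \<tau>) \<in> A" "(\<sigma>, \<tau>') \<in> A" for \<sigma> \<tau> \<tau>'
    using that by (meson eqI facet in_K oldest)
  have uniq_facet: "\<sigma> = \<sigma>'" if "(\<sigma>, \<tau>) \<in> A" "(\<sigma>', \<tau>) \<in> A" for \<sigma> \<sigma>' \<tau>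
    using that by (meson eqI facet in_K youngest)
  have no_chain: False if A: "(\<sigma>, \<tau>) \<in> A" "(\<tau>, \<omega>) \<in> A" for \<sigma> \<tau> \<omega>
  proof -
    obtain \<tau>' where \<tau>': "\<tau>' \<noteq> \<tau>" "facet K \<sigma> \<tau>'" "facet K \<tau>' \<omega>"
      using second_intermediate_simplex[OF assms(1) facet[OF A(1)] facet[OF A(2)]] .
    \<comment> \<open>Both simplices are facets of \<open>\<omega>\<close> and cofacets of
      \<open>\<sigma>\<close>: \<open>\<tau>\<close> is the youngest of them in the first role and
      the oldest in the second.\<close>
    have "\<tau>' = \<tau>"
      using eqI[OF youngest[OF A(2) \<tau>'(3)] oldest[OF A(1) \<tau>'(2)]] in_K \<tau>'(2) facet[OF A(1)]
      by blast
    then show False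
      using \<tau>'(1) by simp
  qed

  \<comment> \<open>The function of the overview with values in \<open>nat\<close>;
    \<open>THE\<close> is well defined by \<open>uniq_cofacet\<close>.\<close>
  define q where "q \<sigma> = (if \<exists>\<tau>. (\<sigma>, \<tau>) \<in> A then p (THE \<tau>. (\<sigma>, \<tau>) \<in> A) else p \<sigma>)" for \<sigma>
  have q_pair: "q \<sigma> = p \<tau>" if "(\<sigma>, \<tau>) \<in> A" for \<sigma> \<tau>
  proof -
    have "(THE \<tau>. (\<sigma>, \<tau>) \<in> A) = \<tau>"
      using that by (rule the_equality) (rule uniq_cofacet[OF _ that])
    then show ?thesis
      using that by (auto simp: q_def)
  qed
  have q_other: "q \<sigma> = p \<sigma>" if "\<nexists>\<tau>. (\<sigma>, \<tau>) \<in> A" for \<sigma>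
    using that by (simp add: q_def)
  have p_le_q: "p \<sigma> \<le> q \<sigma>" for \<sigma>
  proof (cases "\<exists>\<tau>. (\<sigma>, \<tau>) \<in> A")
    case True
    then obtain \<tau> where "(\<sigma>, \<tau>) \<in> A" by blast
    then show ?thesis
      using q_pair p_less[of \<sigma> \<tau>] facet by (fastforce simp: facet_def)
  qed (simp add: q_other)
  have p_mono: "p \<sigma> \<le> p \<tau>" if "\<sigma> \<in> K" "\<tau> \<in> K" "\<sigma> \<subseteq> \<tau>" for \<sigma> \<tau>
    using that p_less[of \<sigma> \<tau>] by (cases "\<sigma> = \<tau>") (auto simp: psubset_eq)
  \<comment> \<open>Bounding by \<open>p \<tau>\<close> instead of \<open>q \<tau>\<close> is
    stronger than monotonicity and also settles the case of equality in \<open>q_eq\<close>.\<close>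
  have q_le_p: "q \<sigma> \<le> p \<tau>" if K: "\<sigma> \<in> K" "\<tau> \<in> K" "\<sigma> \<subset> \<tau>" for \<sigma> \<tau>
  proof (cases "\<exists>\<tau>. (\<sigma>, \<tau>) \<in> A")
    case True
    then obtain \<tau>' where \<tau>': "(\<sigma>, \<tau>') \<in> A" by blast
    obtain \<rho> where \<rho>: "facet K \<sigma> \<rho>" "\<rho> \<subseteq> \<tau>"
      using cofacet_below_coface[OF assms(1) K] .
    have "p \<tau>' \<le> p \<rho>"
      using oldest[OF \<tau>' \<rho>(1)] .
    also have "\<dots> \<le> p \<tau>"
      using \<rho> K in_K by (intro p_mono) auto
    finally show ?thesis
      using q_pair[OF \<tau>'] by simp
  next
    case False
    then show ?thesis
      using q_other p_less[OF K] by simp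
  qed
  have q_mono: "q \<sigma> \<le> q \<tau>" if "\<sigma> \<in> K" "\<tau> \<in> K" "\<sigma> \<subseteq> \<tau>" for \<sigma> \<tau>
    using that q_le_p[of \<sigma> \<tau>] p_le_q[of \<tau>] by (cases "\<sigma> = \<tau>") (auto simp: psubset_eq)
  have q_eq: "facet K \<sigma> \<tau> \<and> q \<sigma> = q \<tau> \<longleftrightarrow> (\<sigma>, \<tau>) \<in> A" for \<sigma> \<tau>
  proof
    assume eq: "facet K \<sigma> \<tau> \<and> q \<sigma> = q \<tau>"
    then have K: "\<sigma> \<in> K" "\<tau> \<in> K" "\<sigma> \<subset> \<tau>"
      by (auto simp: facet_def)
    \<comment> \<open>Squeezed by \<open>q \<sigma> \<le> p \<tau> \<le> q \<tau>\<close>. As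
      \<open>p \<sigma> < p \<tau>\<close>, the value of \<open>\<sigma>\<close> was raised, so
      \<open>\<sigma>\<close> is the facet of an apparent pair.\<close>
    have "q \<sigma> = p \<tau>"
      using eq q_le_p[OF K] p_le_q[of \<tau>] by simp
    then obtain \<tau>' where \<tau>': "(\<sigma>, \<tau>') \<in> A"
      using q_other p_less[OF K] by fastforce
    then have "\<tau>' = \<tau>"
      using \<open>q \<sigma> = p \<tau>\<close> K q_pair[OF \<tau>'] in_K[OF facet[OF \<tau>']] eqI[of \<tau>' \<tau>] by simp
    then show "(\<sigma>, \<tau>) \<in> A"
      using \<tau>' by simp
  next
    assume A: "(\<sigma>, \<tau>) \<in> A"
    \<comment> \<open>Without chains, \<open>\<tau>\<close> is not the facet of another pair and
      keeps its own position.\<close>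
    then have "q \<tau> = p \<tau>"
      using no_chain q_other by blast
    then show "facet K \<sigma> \<tau> \<and> q \<sigma> = q \<tau>"
      using A q_pair facet by simp
  qed

  define f :: "'a set \<Rightarrow> real" where "f \<sigma> = real (q \<sigma>)" for \<sigma>
  have pairs: "facet K \<sigma> \<tau> \<and> f \<sigma> = f \<tau> \<longleftrightarrow> (\<sigma>, \<tau>) \<in> A" for \<sigma> \<tau>
    using q_eq by (simp add: f_def)
  have "monotonic K f"
    using q_mono by (simp add: monotonic_def f_def)
  moreover have "disjoint (level_pairs K f)"
  proof -
    have same: "{\<sigma>, \<tau>} = {\<sigma>', \<tau>'}"
      if A: "(\<sigma>, \<tau>) \<in> A" "(\<sigma>', \<tau>') \<in> A" and meet: "{\<sigma>, \<tau>} \<inter> {\<sigma>', \<tau>'} \<noteq> {}"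
      for \<sigma> \<tau> \<sigma>' \<tau>'
    proof -
      \<comment> \<open>A simplex shared in opposite roles would form a chain, so the pairs meet in
        a common facet or a common cofacet.\<close>
      have "\<sigma> \<noteq> \<tau>'" "\<tau> \<noteq> \<sigma>'"
        using A no_chain by metis+
      then consider "\<sigma> = \<sigma>'" | "\<tau> = \<tau>'"
        using meet by auto
      then show ?thesis
        using A uniq_facet uniq_cofacet by cases metis+
    qed
    have level: "\<exists>\<sigma> \<tau>. b = {\<sigma>, \<tau>} \<and> (\<sigma>, \<tau>) \<in> A" if "b \<in> level_pairs K f" for b
      using that unfolding level_pairs_def pairs by simp
    show ?thesis
    proof (rule disjointI)
      fix b c assume "b \<in> level_pairs K f" "c \<in> level_pairs K f" "b \<noteq> c"
      then show "b \<inter> c = {}"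
        using level same by metis
    qed
  qed
  ultimately have "discrete_morse_function K f"
    by (simp add: discrete_morse_function_def)
  moreover have "vector_field_pairs K (discrete_gradient K f) = apparent_pairs K xs"
    unfolding vector_field_pairs_discrete_gradient pairs by (auto simp: A_def)
  ultimately show ?thesis
    by blast
qed

end
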